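(* Let $\mathcal I\subseteq\mathbb R$ be an interval, let $(Q_\nu)_{\nu\in\mathcal I}$ be a family of probability measures on $\mathbb N_0$ with common support $S\subseteq\mathbb N_0$, so that $q_\nu(n)=Q_\nu(\{n\})>0$ for $n\in S$, and let $F$ be a fixed probability measure on $\mathbb N=\{1,2,\dots\}$. Denote the density (mass function) of the compound law $C_\nu$ by $$f_\nu(k)=\sum_{n\in S}q_\nu(n)F^{*n}(\{k\}).$$ If $\nu\mapsto q_\nu(n)$ is differentiable on $\mathcal I$ for every $n\in S$, then for $k$ in the common support of the $C_\nu$, the compound score is $$s_\nu(k):=\partial_\nu\log f_\nu(k)=\mathbb E[\gamma_\nu(N)\mid X=k],$$ where $\gamma_\nu(n)=\partial_\nu\log q_\nu(n)$ and the expectation is taken under the joint law of $(N,X)$ at the current parameter value $\nu$.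
   Context: $\mathbb N_0=\{0\}\cup\mathbb N$. Convolution powers: $F^{*0}=\delta_0$ (unit mass at $0$) and $F^{*n}=F^{*(n-1)}*F$ for $n\ge1$. Compound law. For a counting law $Q_\nu$ on $\mathbb N_0$ and a summand law $F$ on $\mathbb N$, let $N$ have law $Q_\nu$ and let $(J_i)_{i\ge1}$ be i.i.d. with law $F$, independent of $N$. Set $X=\sum_{i=1}^N J_i$ (with $X=0$ if $N=0$). $C_\nu$ is the law of $X$. *)

theory Defs
  imports "HOL-Probability.Probability"
begin

text \<open>Probability measures on the natural numbers are represented as \<open>nat pmf\<close>, so that
  \<open>pmf Q n\<close> is the mass at \<open>n\<close> and \<open>set_pmf Q\<close> is the support.\<close>

fun conv_power :: "nat pmf \<Rightarrow> nat \<Rightarrow> nat pmf" where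
  "conv_power F 0 = return_pmf 0"
| "conv_power F (Suc n) = map_pmf (\<lambda>(x, y). x + y) (pair_pmf (conv_power F n) F)"

text \<open>A realisation of the compound model on a probability space \<open>M\<close>. The summands are the \<open>J i\<close> with
  \<open>i \<ge> 1\<close>; the index \<open>0\<close> is used for \<open>N\<close> to state that \<open>N, J 1, J 2, \<dots>\<close> are mutually
  independent, i.e. that the \<open>J i\<close> are independent and \<open>N\<close> is independent of their sequence.\<close>

locale compound_model = prob_space M
  for M :: "'w measure" and N :: "'w \<Rightarrow> nat" and J :: "nat \<Rightarrow> 'w \<Rightarrow> nat"
    and Q :: "nat pmf" and F :: "nat pmf" +
  assumes law_N: "distr M (count_space UNIV) N = measure_pmf Q"
    and law_J: "\<And>i. i \<ge> 1 \<Longrightarrow> distr M (count_space UNIV) (J i) = measure_pmf F"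
    and indep: "indep_vars (\<lambda>_. count_space UNIV) (\<lambda>i. if i = 0 then N else J i) UNIV"

definition compound_sum :: "('w \<Rightarrow> nat) \<Rightarrow> (nat \<Rightarrow> 'w \<Rightarrow> nat) \<Rightarrow> 'w \<Rightarrow> nat" where
  "compound_sum N J \<omega> = (\<Sum>i=1..N \<omega>. J i \<omega>)"

definition compound_law ::
    "'w measure \<Rightarrow> ('w \<Rightarrow> nat) \<Rightarrow> (nat \<Rightarrow> 'w \<Rightarrow> nat) \<Rightarrow> nat measure" where
  "compound_law M N J = distr M (count_space UNIV) (compound_sum N J)"

definition compound_mass :: "nat set \<Rightarrow> nat pmf \<Rightarrow> nat pmf \<Rightarrow> nat \<Rightarrow> real" where
  "compound_mass S Q F k = (\<Sum>\<^sub>\<infinity>n\<in>S. pmf Q n * pmf (conv_power F n) k)"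

definition atoms :: "nat measure \<Rightarrow> nat set" where
  "atoms C = {k. measure C {k} > 0}"

text \<open>The derivative of \<open>log g\<close> at \<open>\<nu>\<close> relative to the interval \<open>I\<close>, hence the ordinary
  derivative at interior points and the one-sided one at endpoints belonging to \<open>I\<close>.\<close>

definition log_deriv :: "real set \<Rightarrow> (real \<Rightarrow> real) \<Rightarrow> real \<Rightarrow> real" where
  "log_deriv I g \<nu> = vector_derivative (\<lambda>\<mu>. ln (g \<mu>)) (at \<nu> within I)"

text \<open>For an event \<open>A\<close> of positive probability, \<open>uniform_measure M A\<close> is the conditional
  probability \<open>M(\<cdot> | A)\<close>.\<close>

definition cond_expectation :: "'w measure \<Rightarrow> ('w \<Rightarrow> real) \<Rightarrow> 'w set \<Rightarrow> real" where
  "cond_expectation M Y A = (\<integral>\<omega>. Y \<omega> \<partial>uniform_measure M A)"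

end

theory Submission
  imports Defs
begin

text \<open>The parameter enters the compound mass only through the counting law:
  \<open>f\<^sub>\<nu>(k) = \<Sum> q\<^sub>\<nu>(n) F\<^sup>*\<^sup>n({k})\<close> is a mixture of the parameter-free numbers \<open>F\<^sup>*\<^sup>n({k})\<close>.
  Since every summand is at least \<open>1\<close>, a sum of \<open>n\<close> of them cannot be smaller than \<open>n\<close>, so
  only the indices \<open>n \<le> k\<close> contribute and the mixture is finite. It can therefore be
  differentiated term by term, and writing
  \<open>q' = (log q)' q\<close> turns the score \<open>f'/f\<close> into the average of the \<open>\<gamma>\<^sub>\<nu>(n)\<close> with weights
  \<open>q\<^sub>\<nu>(n) F\<^sup>*\<^sup>n({k}) / f\<^sub>\<nu>(k)\<close> (lemma \<open>log_deriv_mixture\<close>).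

  By independence, \<open>q\<^sub>\<nu>(n) F\<^sup>*\<^sup>n({k})\<close> is the probability of \<open>{N = n, X = k}\<close>
  (lemma \<open>prob_N_compound_sum\<close>), and summing over \<open>n\<close> shows that \<open>f\<^sub>\<nu>(k)\<close> is the probability
  of \<open>{X = k}\<close>. Hence the weights are the conditional probabilities of \<open>{N = n}\<close> given
  \<open>{X = k}\<close>. Under this conditional law \<open>N\<close> takes finitely many values, so every function of
  \<open>N\<close> is integrable and its expectation is the same weighted average
  (lemma \<open>cond_expectation_given_compound_sum\<close>).

  The support of the compound law depends only on which \<open>q\<^sub>\<nu>(n)\<close> are positive, that is, on
  \<open>S\<close> and \<open>F\<close> (lemma \<open>compound_mass_pos_iff\<close>), so it is the same for all parameters.\<close>

section \<open>Convolution powers\<close>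

lemma pmf_conv_power_Suc:
  "pmf (conv_power F (Suc n)) k = (\<Sum>j\<le>k. pmf (conv_power F n) j * pmf F (k - j))"
proof -
  \<comment> \<open>Parametrise the antidiagonal by its first coordinate; truncated subtraction is exact there.\<close>
  have split: "{z. case z of (x, y) \<Rightarrow> x + y = k} = (\<lambda>j. (j, k - j)) ` {..k}"
    by (auto simp: image_iff)
  have "pmf (conv_power F (Suc n)) k =
      measure (pair_pmf (conv_power F n) F) {z. case z of (x, y) \<Rightarrow> x + y = k}"
    by (simp add: pmf_map vimage_def case_prod_beta)
  also have "\<dots> = (\<Sum>z\<in>(\<lambda>j. (j, k - j)) ` {..k}. pmf (pair_pmf (conv_power F n) F) z)"
    unfolding split by (rule measure_measure_pmf_finite) simp
  also have "\<dots> = (\<Sum>j\<le>k. pmf (conv_power F n) j * pmf F (k - j))"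
    by (subst sum.reindex) (auto simp: inj_on_def pmf_pair)
  finally show ?thesis .
qed

text \<open>A sum of \<open>n\<close> positive integers is at least \<open>n\<close>.\<close>

lemma pmf_conv_power_eq_0:
  assumes "set_pmf F \<subseteq> {1..}" and "k < n"
  shows "pmf (conv_power F n) k = 0"
  using assms(2)
proof (induction n arbitrary: k)
  case (Suc n)
  have "pmf (conv_power F n) j * pmf F (k - j) = 0" if "j \<le> k" for j
  proof (cases "j < n")
    case False
    \<comment> \<open>Here \<open>n \<le> j \<le> k < Suc n\<close>, so the last summand would have to vanish.\<close>
    then have "k - j = 0" using Suc.prems that by simp
    then show ?thesis using assms(1) by (auto simp: set_pmf_eq)
  qed (simp add: Suc.IH)
  then show ?case unfolding pmf_conv_power_Suc by (intro sum.neutral) auto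
qed simp

text \<open>Truncating the series depends on \<open>F\<close> and \<open>k\<close> alone. In a family of counting laws,
  \<open>\<mu> \<mapsto> compound_mass S (Q \<mu>) F k\<close> is therefore one and the same finite sum for all real \<open>\<mu>\<close>,
  and the two functions can be interchanged under a derivative.\<close>

lemma compound_mass_eq_sum:
  assumes "set_pmf F \<subseteq> {1..}"
  shows "compound_mass S Q F k = (\<Sum>n\<in>S \<inter> {..k}. pmf Q n * pmf (conv_power F n) k)"
proof -
  have "compound_mass S Q F k = (\<Sum>\<^sub>\<infinity>n\<in>S \<inter> {..k}. pmf Q n * pmf (conv_power F n) k)"
    unfolding compound_mass_def
    by (rule infsum_cong_neutral) (auto simp: pmf_conv_power_eq_0[OF assms])
  then show ?thesis by simp
qed

section \<open>Sums of independent variables\<close>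

lemma (in prob_space) prob_add_nat:
  fixes A B :: "'a \<Rightarrow> nat"
  assumes "indep_var (count_space UNIV) A (count_space UNIV) B"
  shows "prob {\<omega> \<in> space M. A \<omega> + B \<omega> = k} =
    (\<Sum>j\<le>k. prob {\<omega> \<in> space M. A \<omega> = j} * prob {\<omega> \<in> space M. B \<omega> = k - j})"
proof -
  have [measurable]: "A \<in> measurable M (count_space UNIV)" "B \<in> measurable M (count_space UNIV)"
    using assms by (auto dest: indep_var_rv1 indep_var_rv2)
  have "{\<omega> \<in> space M. A \<omega> + B \<omega> = k} = (\<Union>j\<le>k. {\<omega> \<in> space M. A \<omega> = j \<and> B \<omega> = k - j})"
    by auto
  then have "prob {\<omega> \<in> space M. A \<omega> + B \<omega> = k} =
      (\<Sum>j\<le>k. prob {\<omega> \<in> space M. A \<omega> = j \<and> B \<omega> = k - j})"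
    by (simp only:) (subst finite_measure_finite_Union, auto simp: disjoint_family_on_def)
  also have "\<dots> = (\<Sum>j\<le>k. prob {\<omega> \<in> space M. A \<omega> = j} * prob {\<omega> \<in> space M. B \<omega> = k - j})"
  proof (rule sum.cong[OF refl])
    fix j
    show "prob {\<omega> \<in> space M. A \<omega> = j \<and> B \<omega> = k - j} =
        prob {\<omega> \<in> space M. A \<omega> = j} * prob {\<omega> \<in> space M. B \<omega> = k - j}"
      using indep_varD[OF assms, of "{j}" "{k - j}"]
      by (simp add: vimage_def Int_def conj_commute)
  qed
  finally show ?thesis .
qed

text \<open>Disjoint blocks of an independent family are independent, and so are measurable functions of
  them. The sum over a block is measurable because every set of natural numbers is Borel. Singleton blocks let the lemma also separate a single variable from a sum.\<close>

lemma (in prob_space) indep_var_sums_nat: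
  fixes Z :: "'i \<Rightarrow> 'a \<Rightarrow> nat"
  assumes ind: "indep_vars (\<lambda>_. count_space UNIV) Z K"
    and AB: "A \<inter> B = {}" "A \<subseteq> K" "B \<subseteq> K"
  shows "indep_var (count_space UNIV) (\<lambda>\<omega>. \<Sum>i\<in>A. Z i \<omega>) (count_space UNIV) (\<lambda>\<omega>. \<Sum>i\<in>B. Z i \<omega>)"
proof -
  have m: "(\<lambda>f. \<Sum>i\<in>L. f i) \<in> measurable (PiM L (\<lambda>_. count_space UNIV)) (count_space (UNIV :: nat set))"
    for L :: "'i set"
  proof -
    have "(\<lambda>f. \<Sum>i\<in>L. f i) \<in> borel_measurable (PiM L (\<lambda>_. count_space (UNIV :: nat set)))"
      by (intro borel_measurable_sum)
        (rule measurable_compose[OF measurable_component_singleton], auto)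
    then show ?thesis
      by (simp cong: measurable_cong_sets add: sets_borel_eq_count_space)
  qed
  have "(\<lambda>f. \<Sum>i\<in>L. f i) \<circ> (\<lambda>\<omega>. restrict (\<lambda>i. Z i \<omega>) L) = (\<lambda>\<omega>. \<Sum>i\<in>L. Z i \<omega>)" for L
    by (auto cong: sum.cong)
  then show ?thesis
    using indep_var_compose[OF indep_var_restrict[OF ind AB] m m] by simp
qed

context compound_model
begin

text \<open>The independent family of the model, in which index \<open>0\<close> carries the counting variable.\<close>

abbreviation Z :: "nat \<Rightarrow> 'w \<Rightarrow> nat" where
  "Z \<equiv> \<lambda>i. if i = 0 then N else J i"

lemma measurable_N [measurable]: "N \<in> measurable M (count_space UNIV)"
  using indep unfolding indep_vars_def by (auto dest: spec[of _ 0])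

lemma measurable_J [measurable]: "i \<ge> 1 \<Longrightarrow> J i \<in> measurable M (count_space UNIV)"
  using indep unfolding indep_vars_def by (auto dest: spec[of _ i])

lemma prob_N: "prob {\<omega> \<in> space M. N \<omega> = n} = pmf Q n"
proof -
  have "prob {\<omega> \<in> space M. N \<omega> = n} = measure (distr M (count_space UNIV) N) {n}"
    by (subst measure_distr) (auto intro!: arg_cong[where f = prob])
  then show ?thesis by (simp add: law_N pmf.rep_eq)
qed

lemma prob_J:
  assumes "i \<ge> 1"
  shows "prob {\<omega> \<in> space M. J i \<omega> = n} = pmf F n"
proof -
  have "prob {\<omega> \<in> space M. J i \<omega> = n} = measure (distr M (count_space UNIV) (J i)) {n}"
    using assms by (subst measure_distr) (auto intro!: arg_cong[where f = prob])
  then show ?thesis by (simp add: law_J[OF assms] pmf.rep_eq)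
qed

lemma sum_Z: "(\<Sum>i=1..n. Z i \<omega>) = (\<Sum>i=1..n. J i \<omega>)"
  by (intro sum.cong) auto

text \<open>The sum with a deterministic number of terms has law \<open>F\<^sup>*\<^sup>n\<close>: the last summand is
  independent of the preceding ones, so both sides satisfy the same convolution recursion.\<close>

lemma prob_partial_sum: "prob {\<omega> \<in> space M. (\<Sum>i=1..n. J i \<omega>) = k} = pmf (conv_power F n) k"
proof (induction n arbitrary: k)
  case 0
  show ?case by (auto simp: prob_space indicator_def)
next
  case (Suc n)
  have "indep_var (count_space UNIV) (\<lambda>\<omega>. \<Sum>i=1..n. Z i \<omega>)
      (count_space UNIV) (\<lambda>\<omega>. \<Sum>i\<in>{Suc n}. Z i \<omega>)"
    by (rule indep_var_sums_nat[OF indep]) auto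
  then have "indep_var (count_space UNIV) (\<lambda>\<omega>. \<Sum>i=1..n. J i \<omega>) (count_space UNIV) (J (Suc n))"
    unfolding sum_Z by simp
  from prob_add_nat[OF this, of k] show ?case
    unfolding pmf_conv_power_Suc by (simp add: Suc.IH[unfolded One_nat_def] prob_J)
qed

text \<open>On \<open>{N = n}\<close> the random sum coincides with the sum of the first \<open>n\<close> summands, which is
  independent of \<open>N\<close>.\<close>

lemma prob_N_compound_sum:
  "prob {\<omega> \<in> space M. N \<omega> = n \<and> compound_sum N J \<omega> = k} = pmf Q n * pmf (conv_power F n) k"
proof -
  have "indep_var (count_space UNIV) (\<lambda>\<omega>. \<Sum>i\<in>{0}. Z i \<omega>)
      (count_space UNIV) (\<lambda>\<omega>. \<Sum>i=1..n. Z i \<omega>)"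
    by (rule indep_var_sums_nat[OF indep]) auto
  then have "indep_var (count_space UNIV) N (count_space UNIV) (\<lambda>\<omega>. \<Sum>i=1..n. J i \<omega>)"
    unfolding sum_Z by simp
  from indep_varD[OF this, of "{n}" "{k}"]
  have "prob {\<omega> \<in> space M. N \<omega> = n \<and> (\<Sum>i=1..n. J i \<omega>) = k} =
      prob {\<omega> \<in> space M. N \<omega> = n} * prob {\<omega> \<in> space M. (\<Sum>i=1..n. J i \<omega>) = k}"
    by (simp add: vimage_def Int_def conj_commute)
  moreover have "{\<omega> \<in> space M. N \<omega> = n \<and> compound_sum N J \<omega> = k} =
      {\<omega> \<in> space M. N \<omega> = n \<and> (\<Sum>i=1..n. J i \<omega>) = k}"
    by (auto simp: compound_sum_def)
  ultimately show ?thesis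
    by (simp only: prob_N prob_partial_sum)
qed

lemma measurable_compound_sum [measurable]:
  "compound_sum N J \<in> measurable M (count_space UNIV)"
proof -
  have "(\<lambda>\<omega>. \<Sum>i=1..n. J i \<omega>) \<in> measurable M (count_space UNIV)" for n
  proof -
    have "(\<lambda>\<omega>. \<Sum>i=1..n. J i \<omega>) \<in> borel_measurable M"
      by (intro borel_measurable_sum) (rule measurable_compose[OF measurable_J], auto)
    then show ?thesis
      by (simp cong: measurable_cong_sets add: sets_borel_eq_count_space)
  qed
  then have "(\<lambda>\<omega>. \<Sum>i=1..N \<omega>. J i \<omega>) \<in> measurable M (count_space UNIV)"
    by (rule measurable_compose_countable) simp
  then show ?thesis
    by (simp add: compound_sum_def[abs_def])
qed

text \<open>This confines \<open>N\<close> to a finite set once \<open>X = k\<close> is known. The excluded events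
  \<open>{N = n, X = k}\<close> are null because their joint mass has a vanishing factor, and there are
  countably many of them.\<close>

lemma AE_N_in_support:
  assumes "set_pmf F \<subseteq> {1..}"
  shows "AE \<omega> in M. compound_sum N J \<omega> = k \<longrightarrow> N \<omega> \<in> set_pmf Q \<inter> {..k}"
proof -
  have null: "AE \<omega> in M. \<not> (N \<omega> = n \<and> compound_sum N J \<omega> = k)" if "n \<notin> set_pmf Q \<inter> {..k}" for n
  proof (rule AE_I)
    show "{\<omega> \<in> space M. \<not> \<not> (N \<omega> = n \<and> compound_sum N J \<omega> = k)} \<subseteq>
        {\<omega> \<in> space M. N \<omega> = n \<and> compound_sum N J \<omega> = k}"
      by auto
    have "pmf Q n * pmf (conv_power F n) k = 0"
      using that pmf_conv_power_eq_0[OF assms] by (auto simp: set_pmf_iff)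
    then show "emeasure M {\<omega> \<in> space M. N \<omega> = n \<and> compound_sum N J \<omega> = k} = 0"
      using prob_N_compound_sum[of n k] by (simp add: emeasure_eq_measure)
  qed simp
  have "AE \<omega> in M. \<forall>n. n \<notin> set_pmf Q \<inter> {..k} \<longrightarrow> \<not> (N \<omega> = n \<and> compound_sum N J \<omega> = k)"
    unfolding AE_all_countable
  proof
    fix n
    show "AE \<omega> in M. n \<notin> set_pmf Q \<inter> {..k} \<longrightarrow> \<not> (N \<omega> = n \<and> compound_sum N J \<omega> = k)"
      by (cases "n \<in> set_pmf Q \<inter> {..k}") (use null[of n] in simp_all)
  qed
  then show ?thesis by eventually_elim auto
qed

lemma prob_compound_sum:
  assumes "set_pmf F \<subseteq> {1..}"
  shows "prob {\<omega> \<in> space M. compound_sum N J \<omega> = k} = compound_mass (set_pmf Q) Q F k"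
proof -
  let ?A = "set_pmf Q \<inter> {..k}"
  have "prob {\<omega> \<in> space M. compound_sum N J \<omega> = k} =
      prob (\<Union>n\<in>?A. {\<omega> \<in> space M. N \<omega> = n \<and> compound_sum N J \<omega> = k})"
    using AE_N_in_support[OF assms, of k] by (intro finite_measure_eq_AE) auto
  also have "\<dots> = (\<Sum>n\<in>?A. prob {\<omega> \<in> space M. N \<omega> = n \<and> compound_sum N J \<omega> = k})"
    by (subst finite_measure_finite_Union) (auto simp: disjoint_family_on_def)
  finally show ?thesis
    unfolding compound_mass_eq_sum[OF assms] prob_N_compound_sum .
qed

end

section \<open>Conditional expectations given the compound sum\<close>

text \<open>Almost everywhere \<open>g \<circ> Y\<close> is a finite linear combination of the indicators of the events
  \<open>{Y = n}\<close> with \<open>n \<in> A\<close>.\<close>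

lemma (in prob_space) integral_finite_range:
  fixes g :: "'b \<Rightarrow> real"
  assumes [measurable]: "Y \<in> measurable M (count_space UNIV)"
    and "finite A" and AE: "AE \<omega> in M. Y \<omega> \<in> A"
  shows "integrable M (\<lambda>\<omega>. g (Y \<omega>))"
    and "(\<integral>\<omega>. g (Y \<omega>) \<partial>M) = (\<Sum>n\<in>A. g n * prob {\<omega> \<in> space M. Y \<omega> = n})"
proof -
  let ?h = "\<lambda>\<omega>. \<Sum>n\<in>A. g n * indicator {\<omega> \<in> space M. Y \<omega> = n} \<omega>"
  have [measurable]: "(\<lambda>\<omega>. g (Y \<omega>)) \<in> borel_measurable M"
    by (rule measurable_compose[OF assms(1)]) simp
  have eq: "AE \<omega> in M. g (Y \<omega>) = ?h \<omega>"
    using AE AE_space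
  proof eventually_elim
    case (elim \<omega>)
    then have "?h \<omega> = (\<Sum>n\<in>A. if n = Y \<omega> then g n else 0)"
      by (intro sum.cong) auto
    then show ?case
      using elim \<open>finite A\<close> by simp
  qed
  have h: "integrable M ?h"
    by (intro Bochner_Integration.integrable_sum integrable_mult_right)
      (auto simp: integrable_indicator_iff emeasure_eq_measure)
  show "integrable M (\<lambda>\<omega>. g (Y \<omega>))"
    using h by (subst integrable_cong_AE[OF _ _ eq]) auto
  have "(\<integral>\<omega>. g (Y \<omega>) \<partial>M) = (\<integral>\<omega>. ?h \<omega> \<partial>M)"
    by (rule integral_cong_AE[OF _ _ eq]) auto
  also have "\<dots> = (\<Sum>n\<in>A. \<integral>\<omega>. g n * indicator {\<omega> \<in> space M. Y \<omega> = n} \<omega> \<partial>M)"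
    by (intro Bochner_Integration.integral_sum integrable_mult_right)
      (auto simp: integrable_indicator_iff emeasure_eq_measure)
  also have "\<dots> = (\<Sum>n\<in>A. g n * prob {\<omega> \<in> space M. Y \<omega> = n})"
    by (intro sum.cong) auto
  finally show "(\<integral>\<omega>. g (Y \<omega>) \<partial>M) = (\<Sum>n\<in>A. g n * prob {\<omega> \<in> space M. Y \<omega> = n})" .
qed

text \<open>Conditionally on \<open>X = k\<close> the variable \<open>N\<close> lives on a finite set and has the value \<open>n\<close> with
  probability \<open>q(n) F\<^sup>*\<^sup>n({k}) / f(k)\<close>.\<close>

lemma (in compound_model) cond_expectation_given_compound_sum:
  fixes g :: "nat \<Rightarrow> real" and k :: nat
  defines "E \<equiv> {\<omega> \<in> space M. compound_sum N J \<omega> = k}"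
  assumes F: "set_pmf F \<subseteq> {1..}" and pos: "compound_mass (set_pmf Q) Q F k > 0"
  shows "integrable (uniform_measure M E) (\<lambda>\<omega>. g (N \<omega>))"
    and "cond_expectation M (\<lambda>\<omega>. g (N \<omega>)) E =
      (\<Sum>n\<in>set_pmf Q \<inter> {..k}. g n * (pmf Q n * pmf (conv_power F n) k)) /
        compound_mass (set_pmf Q) Q F k"
proof -
  have E [measurable]: "E \<in> sets M" unfolding E_def by measurable
  have probE: "prob E = compound_mass (set_pmf Q) Q F k"
    unfolding E_def by (rule prob_compound_sum[OF F])
  then have E0: "emeasure M E \<noteq> 0" "emeasure M E \<noteq> \<infinity>"
    using pos by (auto simp: emeasure_eq_measure)
  interpret U: prob_space "uniform_measure M E"
    using E0 by (rule prob_space_uniform_measure)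
  have N': "N \<in> measurable (uniform_measure M E) (count_space UNIV)"
    by measurable
  have AE: "AE \<omega> in uniform_measure M E. N \<omega> \<in> set_pmf Q \<inter> {..k}"
    using AE_N_in_support[OF F, of k] by (intro AE_uniform_measureI) (auto simp: E_def)
  show "integrable (uniform_measure M E) (\<lambda>\<omega>. g (N \<omega>))"
    by (rule U.integral_finite_range(1)[OF N' _ AE]) simp
  have "cond_expectation M (\<lambda>\<omega>. g (N \<omega>)) E =
      (\<Sum>n\<in>set_pmf Q \<inter> {..k}. g n * U.prob {\<omega> \<in> space M. N \<omega> = n})"
    unfolding cond_expectation_def using U.integral_finite_range(2)[OF N' _ AE, of g] by simp
  also have "\<dots> = (\<Sum>n\<in>set_pmf Q \<inter> {..k}. g n * (pmf Q n * pmf (conv_power F n) k) / prob E)"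
  proof (rule sum.cong[OF refl])
    fix n
    have "E \<inter> {\<omega> \<in> space M. N \<omega> = n} = {\<omega> \<in> space M. N \<omega> = n \<and> compound_sum N J \<omega> = k}"
      by (auto simp: E_def)
    then show "g n * U.prob {\<omega> \<in> space M. N \<omega> = n} =
        g n * (pmf Q n * pmf (conv_power F n) k) / prob E"
      using E0 by (simp add: prob_N_compound_sum)
  qed
  finally show "cond_expectation M (\<lambda>\<omega>. g (N \<omega>)) E =
      (\<Sum>n\<in>set_pmf Q \<inter> {..k}. g n * (pmf Q n * pmf (conv_power F n) k)) /
        compound_mass (set_pmf Q) Q F k"
    by (simp add: probE sum_divide_distrib)
qed

section \<open>Logarithmic derivatives of mixtures\<close>

lemma log_deriv_eqI:
  assumes "at x within I \<noteq> bot" and "g x > 0"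
    and "(g has_real_derivative D) (at x within I)"
  shows "log_deriv I g x = D / g x"
proof -
  have "((\<lambda>y. ln (g y)) has_real_derivative D / g x) (at x within I)"
    using assms(2,3) by (auto intro!: derivative_eq_intros)
  then show ?thesis
    unfolding log_deriv_def
    by (intro vector_derivative_within[OF assms(1)])
      (simp add: has_real_derivative_iff_has_vector_derivative)
qed

text \<open>Where \<open>x\<close> is not a limit point of \<open>I\<close> every number is a derivative of every function, so the
  chosen derivative is an arbitrary number, the same for all functions. This arises for a
  one-point parameter interval.\<close>

lemma log_deriv_isolated:
  assumes "at x within I = bot"
  shows "log_deriv I g x = log_deriv I h x"
proof -
  have "((\<lambda>y. ln (u y)) has_vector_derivative D) (at x within I)" for u :: "real \<Rightarrow> real" and D
    using assms by (auto simp: has_vector_derivative_def has_derivative_def bounded_linear_mult_left)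
  then show ?thesis
    unfolding log_deriv_def vector_derivative_def by simp
qed

text \<open>The score of a finite mixture is the average of the component scores, weighted by the
  contributions of the components: each term of \<open>\<Sum> g\<^sub>n' w\<^sub>n\<close> is \<open>(g\<^sub>n'/g\<^sub>n) (g\<^sub>n w\<^sub>n)\<close>. If \<open>x\<close>
  is not a limit point of \<open>I\<close>, all scores at \<open>x\<close> are one and the same number, and the identity
  says that the weights add up to \<open>1\<close>.\<close>

lemma log_deriv_mixture:
  fixes g :: "'a \<Rightarrow> real \<Rightarrow> real" and w :: "'a \<Rightarrow> real" and A :: "'a set"
  defines "m \<equiv> \<lambda>y. \<Sum>n\<in>A. g n y * w n"
  assumes diff: "\<And>n. n \<in> A \<Longrightarrow> g n differentiable (at x within I)"
    and gpos: "\<And>n. n \<in> A \<Longrightarrow> g n x > 0" and mpos: "m x > 0"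
  shows "(\<lambda>y. ln (m y)) differentiable (at x within I)"
    and "log_deriv I m x = (\<Sum>n\<in>A. log_deriv I (g n) x * (g n x * w n)) / m x"
proof -
  obtain D where D: "\<And>n. n \<in> A \<Longrightarrow> (g n has_real_derivative D n) (at x within I)"
    using diff unfolding real_differentiable_def by metis
  have m: "(m has_real_derivative (\<Sum>n\<in>A. D n * w n)) (at x within I)"
    unfolding m_def using D by (auto intro!: DERIV_sum DERIV_cmult_right)
  have "((\<lambda>y. ln (m y)) has_real_derivative (\<Sum>n\<in>A. D n * w n) / m x) (at x within I)"
    using m mpos by (auto intro!: derivative_eq_intros)
  then show "(\<lambda>y. ln (m y)) differentiable (at x within I)"
    by (auto simp: real_differentiable_def)
  show "log_deriv I m x = (\<Sum>n\<in>A. log_deriv I (g n) x * (g n x * w n)) / m x"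
  proof (cases "at x within I = bot")
    case True
    have "(\<Sum>n\<in>A. log_deriv I (g n) x * (g n x * w n)) = (\<Sum>n\<in>A. log_deriv I m x * (g n x * w n))"
      by (intro sum.cong refl arg_cong2[where f = "(*)"] log_deriv_isolated[OF True])
    also have "\<dots> = log_deriv I m x * m x"
      by (simp add: m_def sum_distrib_left)
    finally show ?thesis using mpos by simp
  next
    case False
    have "(\<Sum>n\<in>A. log_deriv I (g n) x * (g n x * w n)) = (\<Sum>n\<in>A. D n * w n)"
    proof (rule sum.cong[OF refl])
      fix n assume "n \<in> A"
      then show "log_deriv I (g n) x * (g n x * w n) = D n * w n"
        using log_deriv_eqI[OF False gpos D] gpos[of n] by simp
    qed
    then show ?thesis using log_deriv_eqI[OF False mpos m] by simp
  qed
qed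

section \<open>The compound score\<close>

lemma compound_mass_pos_iff:
  assumes "set_pmf F \<subseteq> {1..}"
  shows "compound_mass (set_pmf Q) Q F k > 0 \<longleftrightarrow> (\<exists>n\<in>set_pmf Q. k \<in> set_pmf (conv_power F n))"
proof -
  let ?t = "\<lambda>n. pmf Q n * pmf (conv_power F n) k"
  have "compound_mass (set_pmf Q) Q F k > 0 \<longleftrightarrow> (\<Sum>n\<in>set_pmf Q \<inter> {..k}. ?t n) \<noteq> 0"
    unfolding compound_mass_eq_sum[OF assms] by (simp add: less_le sum_nonneg)
  also have "\<dots> \<longleftrightarrow> (\<exists>n\<in>set_pmf Q \<inter> {..k}. ?t n \<noteq> 0)"
    by (subst sum_nonneg_eq_0_iff) auto
  also have "\<dots> \<longleftrightarrow> (\<exists>n\<in>set_pmf Q. k \<in> set_pmf (conv_power F n))"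
    using pmf_conv_power_eq_0[OF assms]
    by (auto simp: set_pmf_iff not_le[symmetric])
  finally show ?thesis .
qed

theorem proposition3p12:
  fixes I :: "real set" and Q :: "real \<Rightarrow> nat pmf" and S :: "nat set" and F :: "nat pmf"
    and M :: "real \<Rightarrow> 'w measure" and N :: "real \<Rightarrow> 'w \<Rightarrow> nat" and J :: "real \<Rightarrow> nat \<Rightarrow> 'w \<Rightarrow> nat"
  defines "C \<equiv> \<lambda>\<nu>. compound_law (M \<nu>) (N \<nu>) (J \<nu>)"
    and "X \<equiv> \<lambda>\<nu>. compound_sum (N \<nu>) (J \<nu>)"
    and "f \<equiv> \<lambda>\<nu>. compound_mass S (Q \<nu>) F"
    and "\<gamma> \<equiv> \<lambda>\<nu> n. log_deriv I (\<lambda>\<mu>. pmf (Q \<mu>) n) \<nu>"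
  assumes "is_interval I"
    and "\<And>\<nu>. \<nu> \<in> I \<Longrightarrow> set_pmf (Q \<nu>) = S"
    and "set_pmf F \<subseteq> {1..}"
    and "\<And>\<nu>. \<nu> \<in> I \<Longrightarrow> compound_model (M \<nu>) (N \<nu>) (J \<nu>) (Q \<nu>) F"
    and "\<And>n. n \<in> S \<Longrightarrow> (\<lambda>\<nu>. pmf (Q \<nu>) n) differentiable_on I"
  shows "(\<forall>\<nu>\<in>I. \<forall>k. measure (C \<nu>) {k} = f \<nu> k) \<and>
    (\<exists>T. (\<forall>\<nu>\<in>I. atoms (C \<nu>) = T) \<and>
      (\<forall>\<nu>\<in>I. \<forall>k\<in>T.
        (\<lambda>\<mu>. ln (f \<mu> k)) differentiable (at \<nu> within I) \<and>
        integrable (uniform_measure (M \<nu>) {\<omega> \<in> space (M \<nu>). X \<nu> \<omega> = k}) (\<lambda>\<omega>. \<gamma> \<nu> (N \<nu> \<omega>)) \<and>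
        log_deriv I (\<lambda>\<mu>. f \<mu> k) \<nu> =
          cond_expectation (M \<nu>) (\<lambda>\<omega>. \<gamma> \<nu> (N \<nu> \<omega>)) {\<omega> \<in> space (M \<nu>). X \<nu> \<omega> = k}))"
proof -
  note supp = assms(6) and F = assms(7) and model = assms(8) and diff = assms(9)
  define T where "T = {k. \<exists>n\<in>S. k \<in> set_pmf (conv_power F n)}"
  have mass: "measure (C \<nu>) {k} = f \<nu> k" if "\<nu> \<in> I" for \<nu> k
  proof -
    interpret compound_model "M \<nu>" "N \<nu>" "J \<nu>" "Q \<nu>" F using model[OF that] .
    have "measure (C \<nu>) {k} = prob {\<omega> \<in> space (M \<nu>). compound_sum (N \<nu>) (J \<nu>) \<omega> = k}"
      unfolding C_def compound_law_def
      by (subst measure_distr) (auto intro!: arg_cong[where f = prob])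
    then show ?thesis
      using prob_compound_sum[OF F] supp[OF that] by (simp add: f_def)
  qed
  have pos: "f \<nu> k > 0 \<longleftrightarrow> k \<in> T" if "\<nu> \<in> I" for \<nu> k
    using compound_mass_pos_iff[OF F, of "Q \<nu>"] supp[OF that] by (simp add: f_def T_def)
  have atoms: "atoms (C \<nu>) = T" if "\<nu> \<in> I" for \<nu>
    using mass[OF that] pos[OF that] by (simp add: atoms_def)
  have score: "(\<lambda>\<mu>. ln (f \<mu> k)) differentiable (at \<nu> within I) \<and>
      integrable (uniform_measure (M \<nu>) {\<omega> \<in> space (M \<nu>). X \<nu> \<omega> = k}) (\<lambda>\<omega>. \<gamma> \<nu> (N \<nu> \<omega>)) \<and>
      log_deriv I (\<lambda>\<mu>. f \<mu> k) \<nu> =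
        cond_expectation (M \<nu>) (\<lambda>\<omega>. \<gamma> \<nu> (N \<nu> \<omega>)) {\<omega> \<in> space (M \<nu>). X \<nu> \<omega> = k}"
    if "\<nu> \<in> I" "k \<in> T" for \<nu> k
  proof -
    interpret compound_model "M \<nu>" "N \<nu>" "J \<nu>" "Q \<nu>" F using model[OF that(1)] .
    let ?A = "S \<inter> {..k}" and ?w = "\<lambda>n. pmf (conv_power F n) k"
    have f_eq: "f \<mu> k = (\<Sum>n\<in>?A. pmf (Q \<mu>) n * ?w n)" for \<mu>
      unfolding f_def by (rule compound_mass_eq_sum[OF F])
    have fpos: "f \<nu> k > 0" using pos that by simp
    have d: "(\<lambda>\<mu>. pmf (Q \<mu>) n) differentiable (at \<nu> within I)" if "n \<in> ?A" for n
      using diff \<open>\<nu> \<in> I\<close> that by (auto simp: differentiable_on_def)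
    have q: "pmf (Q \<nu>) n > 0" if "n \<in> ?A" for n
      using that supp[OF \<open>\<nu> \<in> I\<close>] by (auto intro: pmf_positive)
    note mix = log_deriv_mixture[OF d q fpos[unfolded f_eq]]
    have fpos': "compound_mass (set_pmf (Q \<nu>)) (Q \<nu>) F k > 0"
      using fpos supp[OF that(1)] by (simp add: f_def)
    note cond = cond_expectation_given_compound_sum[OF F fpos', of "\<gamma> \<nu>"]
    show ?thesis
      using mix cond supp[OF that(1)]
      by (simp add: f_eq[symmetric] X_def \<gamma>_def) (simp add: f_def)
  qed
  show ?thesis
    by (intro conjI exI[of _ T] ballI allI mass atoms) (use score in simp_all)
qed

end
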